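(* Let $k\geq 6$ and let $G$ be the graph obtained from the complete graph $K_k$ by inserting two pendent vertices adjacent to some vertex of $K_k$ (both pendent vertices adjacent to the same vertex). Then $G$ has a Braess $K_3$ with the property that exactly one of the three edges of the $K_3$ is a Braess edge in $G$ and the other two edges are not Braess edges in $G$.
   Context: Graphs are finite, simple and undirected. For a connected graph $G$ with at least one edge, the random walk on $G$ has transition matrix $D^{-1}A$ ($A$ adjacency matrix, $D$ diagonal degree matrix), with stationary distribution $w_i=\deg(v_i)/(2|E(G)|)$ and mean first passage times $m_{i,j}$ ($i\ne j$). Kemeny's constant is $\mathcal{K}(G)=\sum_{j\neq i} w_j m_{i,j}$, which is independent of $i$; equivalently $\mathcal{K}(G)=\sum_{j\ge2}\frac{1}{1-\lambda_j}$ over the eigenvalues of $D^{-1}A$ other than the simple eigenvalue $\lambda_1=1$. A Braess $K_\ell$ of a connected graph $G$ is an independent set of $\ell$ vertices such that the graph $\widetilde{G}$ obtained by adding all edges between these vertices satisfies $\mathcal{K}(\widetilde{G})>\mathcal{K}(G)$. The edges of the $K_\ell$ are the pairs of vertices in this set. A Braess edge is a Braess $K_2$. *)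

theory Defs
  imports "HOL-Library.Ramsey" Complex_Main
begin

text \<open>A graph is given by its vertex set V and its set E of edges, each edge being a
  two-element subset of V.\<close>

definition simple_graph :: "'a set \<Rightarrow> 'a set set \<Rightarrow> bool" where
  "simple_graph V E \<longleftrightarrow> finite V \<and> E \<subseteq> [V]\<^bsup>2\<^esup>"

definition connected_graph :: "'a set \<Rightarrow> 'a set set \<Rightarrow> bool" where
  "connected_graph V E \<longleftrightarrow> simple_graph V E \<and> V \<noteq> {} \<and>
     (\<forall>u\<in>V. \<forall>v\<in>V. (u, v) \<in> {(x, y). {x, y} \<in> E}\<^sup>*)"

definition adjacency :: "'a set set \<Rightarrow> 'a \<Rightarrow> 'a \<Rightarrow> real" where
  "adjacency E u v = (if {u, v} \<in> E then 1 else 0)"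

definition degree :: "'a set set \<Rightarrow> 'a \<Rightarrow> nat" where
  "degree E v = card {e \<in> E. v \<in> e}"

text \<open>The entries of the transition matrix $D^{-1}A$.\<close>

definition transition :: "'a set set \<Rightarrow> 'a \<Rightarrow> 'a \<Rightarrow> real" where
  "transition E u v = adjacency E u v / real (degree E u)"

definition stationary :: "'a set set \<Rightarrow> 'a \<Rightarrow> real" where
  "stationary E v = real (degree E v) / (2 * real (card E))"

text \<open>For the random walk $X_0, X_1, \ldots$ started at $X_0 = i$, the number
  first_passage V E j n i is the probability that $X_n = j$ and
  $X_m \neq j$ for $0 < m < n$, computed by conditioning on the first step. The target j stays
  fixed in the recursion, so it comes first and the starting vertex i last.\<close>

fun first_passage :: "'a set \<Rightarrow> 'a set set \<Rightarrow> 'a \<Rightarrow> nat \<Rightarrow> 'a \<Rightarrow> real" where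
  "first_passage V E j 0 i = 0"
| "first_passage V E j (Suc 0) i = transition E i j"
| "first_passage V E j (Suc (Suc n)) i =
     (\<Sum>u\<in>V - {j}. transition E i u * first_passage V E j (Suc n) u)"

text \<open>The expected time of the first visit to j of the walk started at i. On a finite
  connected graph the series converges, the first-passage probabilities decaying geometrically.\<close>

definition mean_first_passage :: "'a set \<Rightarrow> 'a set set \<Rightarrow> 'a \<Rightarrow> 'a \<Rightarrow> real" where
  "mean_first_passage V E i j = (\<Sum>n. real n * first_passage V E j n i)"

text \<open>Kemeny's constant is the common value, over all starting vertices i, of the sum below;
  the description is meaningful for connected graphs with at least one edge, where that
  sum does not depend on i.\<close>

definition kemeny :: "'a set \<Rightarrow> 'a set set \<Rightarrow> real" where
  "kemeny V E = (THE c. \<forall>i\<in>V.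
     (\<Sum>j\<in>V - {i}. stationary E j * mean_first_passage V E i j) = c)"

text \<open>The set $[S]^2$ consists of all pairs of vertices of S, i.e. of the edges that
  are added to the graph.\<close>

definition braess_clique :: "'a set \<Rightarrow> 'a set set \<Rightarrow> nat \<Rightarrow> 'a set \<Rightarrow> bool" where
  "braess_clique V E l S \<longleftrightarrow> connected_graph V E \<and> S \<subseteq> V \<and> card S = l \<and> indep S E \<and>
     kemeny V (E \<union> [S]\<^bsup>2\<^esup>) > kemeny V E"

definition braess_edge :: "'a set \<Rightarrow> 'a set set \<Rightarrow> 'a set \<Rightarrow> bool" where
  "braess_edge V E e \<longleftrightarrow> braess_clique V E 2 e"

text \<open>The graph obtained from the complete graph on the vertex set C by attaching two new
  pendent vertices p and q to the same vertex c of C.\<close>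

definition complete_with_two_pendents ::
    "'a set \<Rightarrow> 'a set set \<Rightarrow> nat \<Rightarrow> bool" where
  "complete_with_two_pendents V E k \<longleftrightarrow>
     (\<exists>C c p q. finite C \<and> card C = k \<and> c \<in> C \<and> p \<notin> C \<and> q \<notin> C \<and> p \<noteq> q \<and>
        V = C \<union> {p, q} \<and> E = [C]\<^bsup>2\<^esup> \<union> {{c, p}, {c, q}})"

end

theory Submission
  imports Defs
begin

text \<open>Ground the Laplacian of a graph at a vertex c and let g be the inverse of the remaining block
  (a Green function). With the degrees d and m edges, the function
  H(i,j) = \<open>\<Sum>\<close> d(k) (g(j,j) - g(i,j) - g(j,k) + g(i,k)), summed over k, solves the first-step equations for
  the mean first passage times, and averaging over j gives
  K = \<open>\<Sum>\<close> d(j) g(j,j) - (\<open>\<Sum>\<close> d(j) d(k) g(j,k)) / 2m.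
  The first-step equations have only one solution because the walk killed at j decays geometrically:
  the hitting time itself is a Lyapunov function.

  Let p, q be the pendent vertices, c their neighbour and x another vertex of the clique. Explicit Green
  functions for the graph and for the graphs with the additional edges pq, px and pq, px, qx turn
  all comparisons into inequalities between rational functions of k; the clique on p, q, x is the Braess
  one, with pq as its only Braess edge.\<close>

section \<open>Mean first passage times\<close>

text \<open>The weight \<open>h\<close> is the expected lifetime of the killed walk:
  \<open>h = 1 + P h\<close> and \<open>1 \<le> h \<le> M\<close> give
  \<open>P h \<le> (1 - 1 / M) h\<close>, so a bound on \<open>d n\<close> by a multiple of
  \<open>h\<close> improves by the factor \<open>r\<close> in each step. The pair \<open>r\<close>,
  \<open>M\<close> is quantified before \<open>d\<close> because one pair serves several
  sequences.\<close>

lemma substochastic_decay: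
  fixes P :: "'a \<Rightarrow> 'a \<Rightarrow> real" and h :: "'a \<Rightarrow> real"
  assumes "finite A"
    and P_nonneg: "\<And>i u. i \<in> A \<Longrightarrow> u \<in> A \<Longrightarrow> 0 \<le> P i u"
    and h_nonneg: "\<And>i. i \<in> A \<Longrightarrow> 0 \<le> h i"
    and h_eq: "\<And>i. i \<in> A \<Longrightarrow> h i = 1 + (\<Sum>u\<in>A. P i u * h u)"
  shows "\<exists>r M. 0 \<le> r \<and> r < 1 \<and> (\<forall>d B n. (\<forall>n. \<forall>i\<in>A. d (Suc n) i = (\<Sum>u\<in>A. P i u * d n u)) \<longrightarrow>
    (\<forall>i\<in>A. \<bar>d 0 i\<bar> \<le> B) \<longrightarrow> (\<forall>i\<in>A. \<bar>d n i\<bar> \<le> B * M * r ^ n))"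
proof -
  \<comment> \<open>The inserted 1 keeps the maximum meaningful for empty \<open>A\<close> and gives
    \<open>1 \<le> M\<close>, hence \<open>0 \<le> r\<close>.\<close>
  define M where "M = Max (insert 1 (h ` A))"
  have hM: "h i \<le> M" if "i \<in> A" for i
    using that \<open>finite A\<close> by (auto simp: M_def)
  have "1 \<le> M"
    using \<open>finite A\<close> by (auto simp: M_def)
  have h1: "1 \<le> h i" if "i \<in> A" for i
    using that h_eq[OF that] P_nonneg h_nonneg by (simp add: sum_nonneg)
  define r where "r = 1 - 1 / M"
  have r: "0 \<le> r" "r < 1"
    using \<open>1 \<le> M\<close> by (auto simp: r_def)
  have h_contract: "(\<Sum>u\<in>A. P i u * h u) \<le> r * h i" if "i \<in> A" for i
  proof -
    have "h i / M \<le> 1"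
      using hM[OF that] \<open>1 \<le> M\<close> by simp
    then show ?thesis
      using h_eq[OF that] by (simp add: r_def left_diff_distrib)
  qed
  have "\<bar>d n i\<bar> \<le> B * M * r ^ n"
    if step: "\<And>n i. i \<in> A \<Longrightarrow> d (Suc n) i = (\<Sum>u\<in>A. P i u * d n u)"
      and init: "\<And>i. i \<in> A \<Longrightarrow> \<bar>d 0 i\<bar> \<le> B" and "i \<in> A" for d B n i
  proof -
    have "0 \<le> B"
      using init[OF \<open>i \<in> A\<close>] by linarith
    \<comment> \<open>The induction carries the weight \<open>h i\<close>, since rows of
      \<open>P\<close> may sum to 1 and then the plain maximum norm need not contract. Only
      afterwards is \<open>h i\<close> replaced by \<open>M\<close>.\<close>
    have bound: "\<bar>d n i\<bar> \<le> B * r ^ n * h i" if "i \<in> A" for i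
      using that
    proof (induction n arbitrary: i)
      case 0
      have "B \<le> B * h i"
        using h1[OF 0] \<open>0 \<le> B\<close> by (simp add: mult_le_cancel_left1)
      with init[OF 0] show ?case by simp
    next
      case (Suc n)
      have "\<bar>d (Suc n) i\<bar> \<le> (\<Sum>u\<in>A. P i u * \<bar>d n u\<bar>)"
        unfolding step[OF Suc.prems]
        by (rule order.trans[OF sum_abs])
           (use Suc.prems P_nonneg in \<open>auto simp: abs_mult intro!: sum_mono\<close>)
      also have "\<dots> \<le> (\<Sum>u\<in>A. P i u * (B * r ^ n * h u))"
        using Suc P_nonneg by (intro sum_mono mult_left_mono) auto
      also have "\<dots> = B * r ^ n * (\<Sum>u\<in>A. P i u * h u)"
        by (simp add: sum_distrib_left algebra_simps)
      also have "\<dots> \<le> B * r ^ n * (r * h i)"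
        using h_contract[OF Suc.prems] \<open>0 \<le> B\<close> r by (intro mult_left_mono) auto
      finally show ?case by (simp add: algebra_simps)
    qed
    have "B * r ^ n * h i \<le> B * r ^ n * M"
      using hM[OF \<open>i \<in> A\<close>] \<open>0 \<le> B\<close> r by (intro mult_left_mono) auto
    with bound[OF \<open>i \<in> A\<close>] show ?thesis by (simp add: algebra_simps)
  qed
  with r show ?thesis by blast
qed

text \<open>The mean first passage time and \<open>H\<close> solve the same first-step equations, so
  their difference is a fixed point of the walk killed at \<open>j\<close>, and decay leaves only
  zero. The solution \<open>H\<close> itself provides the weight for that decay.\<close>

lemma mean_first_passage_unique:
  assumes "finite V"
    and P_nonneg: "\<And>i u. i \<in> V \<Longrightarrow> u \<in> V \<Longrightarrow> 0 \<le> transition E i u"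
    and P_sum: "\<And>i. i \<in> V \<Longrightarrow> (\<Sum>u\<in>V. transition E i u) = 1"
    and "j \<in> V" "H j = 0"
    and H_eq: "\<And>i. i \<in> V - {j} \<Longrightarrow> H i = 1 + (\<Sum>u\<in>V. transition E i u * H u)"
    and "i \<in> V - {j}"
  shows "mean_first_passage V E i j = H i"
proof -
  define A where "A = V - {j}"
  have "finite A" "A \<subseteq> V"
    using \<open>finite V\<close> by (auto simp: A_def)
  let ?P = "transition E"
  let ?F = "first_passage V E j"
  have P_sum_A: "(\<Sum>u\<in>A. ?P i u) = 1 - ?P i j" if "i \<in> A" for i
    using P_sum[of i] that \<open>finite V\<close> \<open>j \<in> V\<close> by (simp add: A_def sum_diff1)
  have H_eq_A: "H i = 1 + (\<Sum>u\<in>A. ?P i u * H u)" if "i \<in> A" for i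
    using H_eq[of i] that \<open>finite V\<close> \<open>j \<in> V\<close> \<open>H j = 0\<close> by (simp add: A_def sum_diff1)
  \<comment> \<open>Minimum principle: at a minimum \<open>m \<noteq> j\<close>, averaging over the
    neighbours would give \<open>H m \<ge> 1 + H m\<close>. So the minimum is
    \<open>H j = 0\<close>.\<close>
  have H_nonneg: "0 \<le> H i" if "i \<in> V" for i
  proof -
    obtain m where m: "m \<in> V" "\<And>u. u \<in> V \<Longrightarrow> H m \<le> H u"
      using \<open>finite V\<close> \<open>j \<in> V\<close> arg_min_if_finite(1)[of V H] arg_min_least[of V _ H] by blast
    have "m = j"
    proof (rule ccontr)
      assume "m \<noteq> j"
      have "H m = (\<Sum>u\<in>V. ?P m u * H m)"
        using P_sum[OF m(1)] by (simp flip: sum_distrib_right)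
      also have "\<dots> \<le> (\<Sum>u\<in>V. ?P m u * H u)"
        using m P_nonneg by (intro sum_mono mult_left_mono) auto
      finally show False
        using H_eq[of m] m(1) \<open>m \<noteq> j\<close> by simp
    qed
    then show ?thesis
      using m(2)[OF that] \<open>H j = 0\<close> by simp
  qed
  have P_nonneg_A: "0 \<le> ?P i u" if "i \<in> A" "u \<in> A" for i u
    using that P_nonneg \<open>A \<subseteq> V\<close> by auto
  have H_nonneg_A: "0 \<le> H i" if "i \<in> A" for i
    using that H_nonneg \<open>A \<subseteq> V\<close> by auto
  obtain r M where r: "0 \<le> r" "r < 1" and decay:
    "\<And>d B n i. \<lbrakk>\<And>n i. i \<in> A \<Longrightarrow> d (Suc n) i = (\<Sum>u\<in>A. ?P i u * d n u);
       \<And>i. i \<in> A \<Longrightarrow> \<bar>d 0 i\<bar> \<le> B; i \<in> A\<rbrakk> \<Longrightarrow> \<bar>d n i\<bar> \<le> B * M * r ^ n"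
    using substochastic_decay[of A ?P H, OF \<open>finite A\<close> P_nonneg_A H_nonneg_A H_eq_A]
    by blast
  \<comment> \<open>A fixed point is a constant sequence, and the geometric bound on it tends to
    0.\<close>
  have fixed: "d i = 0" if "\<And>i. i \<in> A \<Longrightarrow> d i = (\<Sum>u\<in>A. ?P i u * d u)" and "i \<in> A" for d i
  proof -
    define B where "B = (\<Sum>i\<in>A. \<bar>d i\<bar>)"
    have "\<bar>d i\<bar> \<le> B" if "i \<in> A" for i
      using that \<open>finite A\<close> unfolding B_def by (intro member_le_sum) auto
    with that decay[of "\<lambda>_. d" B i] have "\<bar>d i\<bar> \<le> B * M * r ^ n" for n
      by blast
    moreover have "(\<lambda>n. B * M * r ^ n) \<longlonglongrightarrow> B * M * 0"
      using r by (intro tendsto_intros LIMSEQ_power_zero) auto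
    ultimately have "\<bar>d i\<bar> \<le> 0"
      by (intro LIMSEQ_le_const[of "\<lambda>n. B * M * r ^ n"]) auto
    then show ?thesis by simp
  qed
  \<comment> \<open>The index is shifted by one because the recursion links positive times only; the
    value at time 0 is the default 0.\<close>
  have F_bound: "\<bar>?F (Suc n) i\<bar> \<le> M * r ^ n" if "i \<in> A" for n i
  proof -
    have "\<bar>?F (Suc 0) i\<bar> \<le> 1" if "i \<in> A" for i
    proof -
      have "?P i j \<le> (\<Sum>u\<in>V. ?P i u)"
        using that \<open>finite V\<close> \<open>j \<in> V\<close> \<open>A \<subseteq> V\<close> P_nonneg by (intro member_le_sum) auto
      then show ?thesis
        using P_sum[of i] P_nonneg[of i j] that \<open>j \<in> V\<close> \<open>A \<subseteq> V\<close> by auto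
    qed
    then show ?thesis
      using decay[of "\<lambda>n. ?F (Suc n)" 1 i n] that by (simp add: A_def)
  qed
  have nF_summable: "summable (\<lambda>n. real (Suc n) * ?F (Suc n) i)" if "i \<in> A" for i
  proof (rule summable_comparison_test')
    show "summable (\<lambda>n. M * (real (Suc n) * r ^ n))"
      using geometric_deriv_sums[of r] r by (intro summable_mult) (auto simp: sums_iff)
    show "norm (real (Suc n) * ?F (Suc n) i) \<le> M * (real (Suc n) * r ^ n)" for n
      using mult_left_mono[OF F_bound[OF that, of n], of "real (Suc n)"]
      by (simp only: real_norm_def abs_mult abs_of_nat mult_ac)
  qed
  have F_summable: "summable (\<lambda>n. ?F (Suc n) i)" if "i \<in> A" for i
  proof (rule summable_comparison_test')
    show "summable (\<lambda>n. M * r ^ n)"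
      using r by (intro summable_mult summable_geometric) auto
    show "norm (?F (Suc n) i) \<le> M * r ^ n" for n
      using F_bound[OF that, of n] by simp
  qed
  \<comment> \<open>\<open>S i\<close> is the probability of ever reaching \<open>j\<close>. It has
    to be shown equal to 1 first, because it enters the equation for the mean
    \<open>m\<close>.\<close>
  define S where "S i = (\<Sum>n. ?F (Suc n) i)" for i
  define m where "m i = (\<Sum>n. real (Suc n) * ?F (Suc n) i)" for i
  have S_eq: "S i = ?P i j + (\<Sum>u\<in>A. ?P i u * S u)" if "i \<in> A" for i
  proof -
    have "S i = ?P i j + (\<Sum>n. ?F (Suc (Suc n)) i)"
      using suminf_split_head[OF F_summable[OF that]] by (simp add: S_def)
    also have "(\<Sum>n. ?F (Suc (Suc n)) i) = (\<Sum>u\<in>A. \<Sum>n. ?P i u * ?F (Suc n) u)"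
      using F_summable by (simp only: first_passage.simps A_def) (intro suminf_sum summable_mult)
    also have "\<dots> = (\<Sum>u\<in>A. ?P i u * S u)"
      using F_summable unfolding S_def by (intro sum.cong refl suminf_mult)
    finally show ?thesis .
  qed
  have "1 - S i = (\<Sum>u\<in>A. ?P i u * (1 - S u))" if "i \<in> A" for i
    using S_eq[OF that] P_sum_A[OF that] by (simp add: right_diff_distrib sum_subtractf)
  from fixed[of "\<lambda>i. 1 - S i", OF this] have S_1: "S i = 1" if "i \<in> A" for i
    using that by simp
  have m_eq: "m i = 1 + (\<Sum>u\<in>A. ?P i u * m u)" if "i \<in> A" for i
  proof -
    have "m i = ?P i j + (\<Sum>n. real (Suc (Suc n)) * ?F (Suc (Suc n)) i)"
      using suminf_split_head[OF nF_summable[OF that]] by (simp add: m_def)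
    \<comment> \<open>Splitting the weight \<open>n + 2\<close> as \<open>(n + 1) + 1\<close>
      produces \<open>m u + S u\<close>. With \<open>S u = 1\<close>, the extra row sum
      \<open>1 - ?P i j\<close> and the leading \<open>?P i j\<close> combine to the constant
      1.\<close>
    also have "(\<lambda>n. real (Suc (Suc n)) * ?F (Suc (Suc n)) i) =
      (\<lambda>n. \<Sum>u\<in>A. ?P i u * (real (Suc n) * ?F (Suc n) u + ?F (Suc n) u))"
      by (simp add: A_def sum_distrib_left algebra_simps)
    also have "(\<Sum>n. \<Sum>u\<in>A. ?P i u * (real (Suc n) * ?F (Suc n) u + ?F (Suc n) u)) =
      (\<Sum>u\<in>A. \<Sum>n. ?P i u * (real (Suc n) * ?F (Suc n) u + ?F (Suc n) u))"
      using F_summable nF_summable by (intro suminf_sum summable_mult summable_add)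
    also have "\<dots> = (\<Sum>u\<in>A. ?P i u * (m u + S u))"
      using F_summable nF_summable unfolding m_def S_def
      by (intro sum.cong refl) (simp only: suminf_mult summable_add suminf_add)
    also have "\<dots> = (\<Sum>u\<in>A. ?P i u * m u) + (\<Sum>u\<in>A. ?P i u)"
      using S_1 by (simp add: distrib_left sum.distrib)
    finally show ?thesis
      using P_sum_A[OF that] by simp
  qed
  have "m i - H i = (\<Sum>u\<in>A. ?P i u * (m u - H u))" if "i \<in> A" for i
    using m_eq[OF that] H_eq_A[OF that] by (simp add: right_diff_distrib sum_subtractf)
  from fixed[of "\<lambda>i. m i - H i", OF this] have "m i = H i"
    using \<open>i \<in> V - {j}\<close> by (simp add: A_def)
  moreover have "mean_first_passage V E i j = m i"
  proof -
    have "summable (\<lambda>n. real n * ?F n i)"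
      using nF_summable[of i] \<open>i \<in> V - {j}\<close> summable_Suc_iff[of "\<lambda>n. real n * ?F n i"]
      by (simp add: A_def)
    from suminf_split_head[OF this] show ?thesis
      by (simp add: m_def mean_first_passage_def)
  qed
  ultimately show ?thesis by simp
qed

section \<open>Kemeny's constant from a grounded Green function\<close>

lemma adjacency_sym: "adjacency E u v = adjacency E v u"
  by (simp add: adjacency_def insert_commute)

lemma degree_eq_sum_adjacency:
  assumes "simple_graph V E"
  shows "real (degree E v) = (\<Sum>u\<in>V. adjacency E v u)"
proof -
  have E: "finite V" "E \<subseteq> [V]\<^bsup>2\<^esup>"
    using assms by (auto simp: simple_graph_def)
  have "{e \<in> E. v \<in> e} = (\<lambda>u. {v, u}) ` {u \<in> V. {v, u} \<in> E}"
  proof (intro equalityI subsetI)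
    fix e assume e: "e \<in> {e \<in> E. v \<in> e}"
    then have "e \<in> [V]\<^bsup>2\<^esup>" using E by auto
    then obtain a b where "e = {a, b}" "a \<in> V" "b \<in> V"
      by (auto simp: nsets_2_eq)
    with e show "e \<in> (\<lambda>u. {v, u}) ` {u \<in> V. {v, u} \<in> E}"
      by (auto simp: insert_commute)
  qed auto
  moreover have "inj_on (\<lambda>u. {v, u}) {u \<in> V. {v, u} \<in> E}"
    by (auto simp: inj_on_def doubleton_eq_iff)
  ultimately have "degree E v = card {u \<in> V. {v, u} \<in> E}"
    by (simp add: degree_def card_image)
  then show ?thesis
    using \<open>finite V\<close> by (simp add: adjacency_def flip: sum.inter_filter)
qed

lemma sum_degree:
  assumes "simple_graph V E"
  shows "(\<Sum>v\<in>V. real (degree E v)) = 2 * real (card E)"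
proof -
  have "finite V" and E: "E \<subseteq> [V]\<^bsup>2\<^esup>"
    using assms by (auto simp: simple_graph_def)
  then have "finite E"
    using finite_subset finite_imp_finite_nsets by blast
  have "card {v \<in> V. v \<in> e} = 2" if "e \<in> E" for e
  proof -
    have "{v \<in> V. v \<in> e} = e" "card e = 2"
      using that E by (auto simp: nsets_def)
    then show ?thesis by simp
  qed
  then have "(\<Sum>v\<in>V. degree E v) = 2 * card E"
    unfolding degree_def by (intro sum_multicount \<open>finite V\<close> \<open>finite E\<close> ballI)
  from arg_cong[OF this, of real] show ?thesis by simp
qed

text \<open>Supplying \<open>g\<close> reduces Kemeny's constant to checking a linear system. Column
  \<open>j\<close> of \<open>g\<close> is the potential of a unit current entering at
  \<open>j\<close> and leaving at the ground \<open>c\<close>.\<close>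

lemma kemeny_eq_grounded_Green:
  fixes g :: "'a \<Rightarrow> 'a \<Rightarrow> real"
  assumes "simple_graph V E"
    and deg_pos: "\<And>v. v \<in> V \<Longrightarrow> 0 < degree E v"
    and "c \<in> V" and g_c: "\<And>i. i \<in> V \<Longrightarrow> g i c = 0"
    and g_eq: "\<And>i j. i \<in> V - {c} \<Longrightarrow> j \<in> V - {c} \<Longrightarrow>
      (\<Sum>u\<in>V. adjacency E i u * (g i j - g u j)) = (if i = j then 1 else 0)"
  shows "kemeny V E = (\<Sum>j\<in>V. real (degree E j) * g j j) -
    (\<Sum>j\<in>V. \<Sum>k\<in>V. real (degree E j) * real (degree E k) * g j k) / (\<Sum>j\<in>V. real (degree E j))"
proof -
  have "finite V" using assms by (simp add: simple_graph_def)
  let ?A = "adjacency E"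
  define d where "d v = real (degree E v)" for v
  define m2 where "m2 = (\<Sum>v\<in>V. d v)"
  have d_sum: "d i = (\<Sum>u\<in>V. ?A i u)" for i
    unfolding d_def by (rule degree_eq_sum_adjacency[OF assms(1)])
  have d_pos: "0 < d v" if "v \<in> V" for v
    using deg_pos[OF that] by (simp add: d_def)
  have "0 < m2"
    unfolding m2_def using d_pos \<open>finite V\<close> \<open>c \<in> V\<close> by (intro sum_pos) auto
  define L where "L f i = (\<Sum>u\<in>V. ?A i u * (f i - f u))" for f i
  have L_sum: "(\<Sum>i\<in>V. L f i) = 0" for f
  proof -
    have "(\<Sum>i\<in>V. \<Sum>u\<in>V. ?A i u * f i) = (\<Sum>i\<in>V. \<Sum>u\<in>V. ?A i u * f u)"
      by (subst sum.swap) (intro sum.cong refl, metis adjacency_sym)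
    then show ?thesis
      by (simp add: L_def right_diff_distrib sum_subtractf)
  qed
  \<comment> \<open>The row at \<open>c\<close>, absent from \<open>g_eq\<close>, is forced:
    \<open>L f\<close> sums to 0 over \<open>V\<close>, so the unit source at \<open>j\<close> needs
    a unit sink at \<open>c\<close>.\<close>
  have L_g: "L (\<lambda>i. g i j) i = (if i = j then 1 else 0) - (if i = c then 1 else 0)"
    if "i \<in> V" "j \<in> V" for i j
  proof (cases "j = c")
    case True
    then show ?thesis
      using that by (simp add: L_def g_c)
  next
    case False
    have off: "L (\<lambda>i. g i j) i = (if i = j then 1 else 0)" if "i \<in> V - {c}" for i
      using g_eq[OF that] \<open>j \<in> V\<close> False by (simp add: L_def)
    have "0 = L (\<lambda>i. g i j) c + (\<Sum>i\<in>V - {c}. L (\<lambda>i. g i j) i)"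
      using L_sum[of "\<lambda>i. g i j"] \<open>finite V\<close> \<open>c \<in> V\<close> by (simp add: sum.remove)
    also have "\<dots> = L (\<lambda>i. g i j) c + 1"
      using off \<open>finite V\<close> \<open>j \<in> V\<close> False by simp
    finally show ?thesis
      using off \<open>i \<in> V\<close> False by auto
  qed
  \<comment> \<open>The terms \<open>g j j - g j k\<close> make \<open>H\<close> vanish at
    \<open>i = j\<close>. In the difference of columns \<open>k\<close> and \<open>j\<close> the
    sinks at \<open>c\<close> cancel, leaving a source of strength \<open>d k\<close> at each
    \<open>k\<close>.\<close>
  define H where "H i j = (\<Sum>k\<in>V. d k * (g j j - g i j - g j k + g i k))" for i j
  have L_H: "L (\<lambda>i. H i j) i = d i" if "i \<in> V - {j}" "j \<in> V" for i j
  proof -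
    have "L (\<lambda>i. H i j) i = (\<Sum>k\<in>V. d k * (L (\<lambda>i. g i k) i - L (\<lambda>i. g i j) i))"
      unfolding L_def H_def sum_subtractf[symmetric] sum_distrib_left
      by (subst sum.swap) (simp add: algebra_simps)
    also have "\<dots> = (\<Sum>k\<in>V. if i = k then d k else 0)"
      using that by (intro sum.cong) (auto simp: L_g)
    also have "\<dots> = d i"
      using that \<open>finite V\<close> by simp
    finally show ?thesis .
  qed
  have P_nonneg: "0 \<le> transition E i u" for i u
    by (simp add: transition_def adjacency_def)
  have P_sum: "(\<Sum>u\<in>V. transition E i u) = 1" if "i \<in> V" for i
    using d_pos[OF that] d_sum[of i] by (simp add: transition_def d_def flip: sum_divide_distrib)
  have H_eq: "H i j = 1 + (\<Sum>u\<in>V. transition E i u * H u j)" if "i \<in> V - {j}" "j \<in> V" for i j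
  proof -
    have "d i * H i j - (\<Sum>u\<in>V. ?A i u * H u j) = d i"
      using L_H[OF that] by (simp add: L_def right_diff_distrib sum_subtractf d_sum sum_distrib_right)
    then have "H i j = 1 + (\<Sum>u\<in>V. ?A i u * H u j) / d i"
      using d_pos[of i] that by (simp add: field_simps)
    then show ?thesis
      by (simp add: transition_def d_def sum_divide_distrib)
  qed
  have H_diag: "H j j = 0" for j
    by (simp add: H_def)
  have mfp: "mean_first_passage V E i j = H i j" if "i \<in> V - {j}" "j \<in> V" for i j
    using that by (intro mean_first_passage_unique[of V E j "\<lambda>i. H i j"]
      \<open>finite V\<close> P_nonneg P_sum H_diag H_eq)
  define K where "K = (\<Sum>j\<in>V. d j * g j j) - (\<Sum>j\<in>V. \<Sum>k\<in>V. d j * d k * g j k) / m2"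
  have "(\<Sum>j\<in>V - {i}. stationary E j * mean_first_passage V E i j) = K" if "i \<in> V" for i
  proof -
    have "(\<Sum>j\<in>V - {i}. stationary E j * mean_first_passage V E i j) =
      (\<Sum>j\<in>V - {i}. d j / m2 * H i j)"
      using that mfp by (intro sum.cong)
        (auto simp: stationary_def d_def m2_def sum_degree[OF assms(1)])
    also have "\<dots> = (\<Sum>j\<in>V. d j / m2 * H i j)"
      using that \<open>finite V\<close> by (simp add: sum_diff1 H_diag)
    also have "\<dots> = (\<Sum>j\<in>V. \<Sum>k\<in>V. d j * d k * (g j j - g i j - g j k + g i k)) / m2"
      by (simp add: H_def sum_divide_distrib sum_distrib_left mult.assoc)
    also have "(\<Sum>j\<in>V. \<Sum>k\<in>V. d j * d k * (g j j - g i j - g j k + g i k)) =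
      (\<Sum>j\<in>V. \<Sum>k\<in>V. d k * (d j * g j j)) - (\<Sum>j\<in>V. \<Sum>k\<in>V. d j * d k * g i j)
      - (\<Sum>j\<in>V. \<Sum>k\<in>V. d j * d k * g j k) + (\<Sum>j\<in>V. \<Sum>k\<in>V. d j * d k * g i k)"
      by (simp add: algebra_simps sum.distrib sum_subtractf)
    \<comment> \<open>Renaming the summation variables makes the two terms containing
      \<open>i\<close> cancel; hence the sum is independent of the starting vertex.\<close>
    also have "(\<Sum>j\<in>V. \<Sum>k\<in>V. d j * d k * g i k) = (\<Sum>j\<in>V. \<Sum>k\<in>V. d j * d k * g i j)"
      by (subst sum.swap) (simp add: mult.commute)
    also have "(\<Sum>j\<in>V. \<Sum>k\<in>V. d k * (d j * g j j)) = m2 * (\<Sum>j\<in>V. d j * g j j)"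
      by (simp add: m2_def sum_distrib_left flip: sum_distrib_right)
    finally show ?thesis
      using \<open>0 < m2\<close> by (simp add: K_def diff_divide_distrib)
  qed
  then have "kemeny V E = K"
    unfolding kemeny_def using \<open>c \<in> V\<close> by (intro the_equality) auto
  then show ?thesis
    by (simp add: K_def m2_def d_def)
qed

section \<open>The complete graph with two pendent vertices\<close>

lemma triple_nsets_2: "a \<noteq> b \<Longrightarrow> a \<noteq> d \<Longrightarrow> b \<noteq> d \<Longrightarrow> [{a, b, d}]\<^bsup>2\<^esup> = {{a, b}, {a, d}, {b, d}}"
  by (auto simp: nsets_2_eq insert_commute)

text \<open>The fractions are the values of Kemeny's constant computed below: \<open>?base\<close>
  for the graph itself, \<open>?edge\<close> with the edge pq added, \<open>?cross\<close> with px,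
  \<open>?triangle\<close> with all three edges. The bound on \<open>k\<close> comes from the last
  inequality, which fails at \<open>k = 5\<close>.\<close>

lemma kemeny_formula_less:
  fixes k :: real
  assumes "6 \<le> k"
  shows "(k ^ 4 - k ^ 3 + 9 * k\<^sup>2 - 11 * k + 8) / (k * (k * (k - 1) + 4)) <
      (k ^ 4 - k ^ 3 / 3 + 37 / 3 * k\<^sup>2 - 17 * k + 12) / (k * (k * (k - 1) + 6))" (is "?base < ?edge")
    and "(k ^ 5 + 10 * k ^ 3 - 3 * k\<^sup>2 + 2 * k + 18) / (k * (k + 1) * (k * (k - 1) + 6)) \<le>
      (k ^ 4 - k ^ 3 + 9 * k\<^sup>2 - 11 * k + 8) / (k * (k * (k - 1) + 4))" (is "?cross \<le> _")
    and "(k ^ 4 - k ^ 3 + 9 * k\<^sup>2 - 11 * k + 8) / (k * (k * (k - 1) + 4)) <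
      (k ^ 5 + 5 / 4 * k ^ 4 + 57 / 4 * k ^ 3 + 11 * k\<^sup>2 - 27 * k + 60) /
      (k * (k + 2) * (k * (k - 1) + 10))" (is "_ < ?triangle")
proof -
  \<comment> \<open>In the variable k - 6 all coefficients of the numerators are nonnegative.\<close>
  define m where "m = k - 6"
  have "0 \<le> m" and k: "k = m + 6"
    using assms by (simp_all add: m_def)
  have pos: "0 < k * (k - 1) + 4" "0 < k * (k - 1) + 6" "0 < k * (k - 1) + 10"
    using assms by (auto intro: add_nonneg_pos)
  have "?edge - ?base =
    (2 / 3 * m ^ 5 + 62 / 3 * m ^ 4 + 754 / 3 * m ^ 3 + 4516 / 3 * m\<^sup>2 + 4450 * m + 5196) /
      (k * (k * (k - 1) + 6) * (k * (k - 1) + 4))"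
    using pos assms by (simp add: divide_simps) (simp add: k algebra_simps eval_nat_numeral)
  also have "\<dots> > 0"
    using pos assms \<open>0 \<le> m\<close> by (intro divide_pos_pos mult_pos_pos add_nonneg_pos) auto
  finally show "?base < ?edge" by simp
  have "?base - ?cross =
    (3 * m ^ 4 + 74 * m ^ 3 + 679 * m\<^sup>2 + 2732 * m + 4020) /
      (k * (k + 1) * (k * (k - 1) + 6) * (k * (k - 1) + 4))"
    using pos assms by (simp add: divide_simps) (simp add: k algebra_simps eval_nat_numeral)
  also have "\<dots> \<ge> 0"
    using pos assms \<open>0 \<le> m\<close> by (intro divide_nonneg_pos mult_pos_pos add_nonneg_nonneg) auto
  finally show "?cross \<le> ?base" by simp
  have "?triangle - ?base =
    (m ^ 6 / 4 + 10 * m ^ 5 + 627 / 4 * m ^ 4 + 1212 * m ^ 3 + 4729 * m\<^sup>2 + 8136 * m + 3392) /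
      (k * (k + 2) * (k * (k - 1) + 10) * (k * (k - 1) + 4))"
    using pos assms by (simp add: divide_simps) (simp add: k algebra_simps eval_nat_numeral)
  also have "\<dots> > 0"
    using pos assms \<open>0 \<le> m\<close> by (intro divide_pos_pos mult_pos_pos add_nonneg_pos) auto
  finally show "?base < ?triangle" by simp
qed

section \<open>The clique with two pendent vertices and a variable set of added edges\<close>

locale clique_with_two_pendents =
  fixes C :: "'a set" and c p q x :: 'a
  assumes finite_C: "finite C" and c: "c \<in> C" and x: "x \<in> C" "x \<noteq> c"
    and pq: "p \<notin> C" "q \<notin> C" "p \<noteq> q"
begin

definition V :: "'a set" where "V = C \<union> {p, q}"

text \<open>These vertices are interchangeable in all graphs considered, so sums over
  \<open>V\<close> split into four special terms and a uniform part.\<close>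

definition Y :: "'a set" where "Y = C - {c, x}"

definition E :: "'a set set \<Rightarrow> 'a set set" where
  "E N = [C]\<^bsup>2\<^esup> \<union> {{c, p}, {c, q}} \<union> N"

lemma Y_neq:
  assumes "y \<in> Y"
  shows "y \<noteq> p" "y \<noteq> q" "y \<noteq> c" "y \<noteq> x" "p \<noteq> y" "q \<noteq> y" "c \<noteq> y" "x \<noteq> y" "y \<in> C"
  using assms pq c x by (auto simp: Y_def)

lemma distinct_vertices:
  "p \<noteq> q" "q \<noteq> p" "p \<noteq> c" "c \<noteq> p" "q \<noteq> c" "c \<noteq> q" "p \<noteq> x" "x \<noteq> p" "q \<noteq> x" "x \<noteq> q" "x \<noteq> c" "c \<noteq> x"
  "p \<notin> Y" "q \<notin> Y" "c \<notin> Y" "x \<notin> Y" "finite Y" "p \<notin> C" "q \<notin> C" "c \<in> C" "x \<in> C"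
  "finite C"
  using finite_C c x pq by (auto simp: Y_def)

lemma V_eq: "V = {p, q, c, x} \<union> Y"
  using c x by (auto simp: V_def Y_def)

declare distinct_vertices [simp] Y_neq [simp]

lemma V_cases: "v \<in> V \<longleftrightarrow> v = p \<or> v = q \<or> v = c \<or> v = x \<or> v \<in> Y"
  by (auto simp: V_eq)

lemma sum_V: "(\<Sum>v\<in>V. f v) = f p + f q + f c + f x + (\<Sum>y\<in>Y. f y)" for f :: "'a \<Rightarrow> real"
proof -
  have "(\<Sum>v\<in>V. f v) = (\<Sum>v\<in>{p, q, c, x}. f v) + (\<Sum>y\<in>Y. f y)"
    unfolding V_eq by (rule sum.union_disjoint) auto
  then show ?thesis by simp
qed

lemma card_Y: "real (card Y) = real (card C) - 2"
proof -
  have "card C = card Y + card {c, x}"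
    unfolding Y_def by (subst card_Diff_subset) (use card_mono[of C "{c, x}"] in auto)
  then show ?thesis by simp
qed

lemma simple_E:
  assumes "N \<subseteq> {{p, q}, {p, x}, {q, x}}"
  shows "simple_graph V (E N)"
proof -
  have "[C]\<^bsup>2\<^esup> \<subseteq> [V]\<^bsup>2\<^esup>" by (rule nsets_mono) (auto simp: V_def)
  then show ?thesis
    using assms by (auto simp: simple_graph_def E_def V_def)
qed

lemma adjacency_E:
  assumes "N \<subseteq> {{p, q}, {p, x}, {q, x}}"
  shows "adjacency (E N) p q = of_bool ({p, q} \<in> N)" "adjacency (E N) q p = of_bool ({p, q} \<in> N)"
    "adjacency (E N) p x = of_bool ({p, x} \<in> N)" "adjacency (E N) x p = of_bool ({p, x} \<in> N)"
    "adjacency (E N) q x = of_bool ({q, x} \<in> N)" "adjacency (E N) x q = of_bool ({q, x} \<in> N)"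
    "adjacency (E N) p c = 1" "adjacency (E N) c p = 1" "adjacency (E N) q c = 1" "adjacency (E N) c q = 1"
    "adjacency (E N) x c = 1" "adjacency (E N) c x = 1"
    "adjacency (E N) v v = 0"
    "y \<in> Y \<Longrightarrow> adjacency (E N) p y = 0" "y \<in> Y \<Longrightarrow> adjacency (E N) q y = 0"
    "y \<in> Y \<Longrightarrow> adjacency (E N) y p = 0" "y \<in> Y \<Longrightarrow> adjacency (E N) y q = 0"
    "y \<in> Y \<Longrightarrow> adjacency (E N) c y = 1" "y \<in> Y \<Longrightarrow> adjacency (E N) y c = 1"
    "y \<in> Y \<Longrightarrow> adjacency (E N) x y = 1" "y \<in> Y \<Longrightarrow> adjacency (E N) y x = 1"
    "y \<in> Y \<Longrightarrow> y' \<in> Y \<Longrightarrow> adjacency (E N) y y' = of_bool (y \<noteq> y')"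
proof -
  have C2: "{u, v} \<in> [C]\<^bsup>2\<^esup> \<longleftrightarrow> u \<in> C \<and> v \<in> C \<and> u \<noteq> v" for u v
    by (auto simp: nsets_2_eq doubleton_eq_iff)
  have other: "e \<notin> N" if "e \<noteq> {p, q}" "e \<noteq> {p, x}" "e \<noteq> {q, x}" for e
    using assms that by auto
  note simps = adjacency_def E_def C2 doubleton_eq_iff insert_commute other
  show "adjacency (E N) p q = of_bool ({p, q} \<in> N)" "adjacency (E N) q p = of_bool ({p, q} \<in> N)"
    "adjacency (E N) p x = of_bool ({p, x} \<in> N)" "adjacency (E N) x p = of_bool ({p, x} \<in> N)"
    "adjacency (E N) q x = of_bool ({q, x} \<in> N)" "adjacency (E N) x q = of_bool ({q, x} \<in> N)"
    "adjacency (E N) p c = 1" "adjacency (E N) c p = 1" "adjacency (E N) q c = 1" "adjacency (E N) c q = 1"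
    "adjacency (E N) x c = 1" "adjacency (E N) c x = 1"
    by (auto simp: simps)
  show "adjacency (E N) v v = 0"
    using simple_E[OF assms] by (auto simp: simple_graph_def adjacency_def nsets_def)
  show "adjacency (E N) p y = 0" "adjacency (E N) q y = 0"
    "adjacency (E N) y p = 0" "adjacency (E N) y q = 0"
    "adjacency (E N) c y = 1" "adjacency (E N) y c = 1"
    "adjacency (E N) x y = 1" "adjacency (E N) y x = 1" if "y \<in> Y"
    using that by (simp_all add: simps)
  show "adjacency (E N) y y' = of_bool (y \<noteq> y')" if "y \<in> Y" "y' \<in> Y"
    using that by (simp add: simps)
qed

text \<open>A column of the Green function is harmonic at the vertices of Y off the diagonal, so its value
  there is half its value at x; only the entries for p, q and x remain as unknowns. The clique thus acts
  on x as a conductance k/2 to c, and Dx is the weight at x after that of Y has been moved there.\<close>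

lemma kemeny_E:
  fixes Gpp Gqq Gpq Gpx Gqx Gxx :: real
  defines "k \<equiv> real (card C)"
  assumes N: "N \<subseteq> {{p, q}, {p, x}, {q, x}}"
    and \<alpha>: "\<alpha> = of_bool ({p, q} \<in> N)" and \<beta>: "\<beta> = of_bool ({p, x} \<in> N)" and \<gamma>: "\<gamma> = of_bool ({q, x} \<in> N)"
    and pp: "(1 + \<alpha> + \<beta>) * Gpp - \<alpha> * Gpq - \<beta> * Gpx = 1"
    and qp: "(1 + \<alpha> + \<gamma>) * Gpq - \<alpha> * Gpp - \<gamma> * Gpx = 0"
    and xp: "(k / 2 + \<beta> + \<gamma>) * Gpx - \<beta> * Gpp - \<gamma> * Gpq = 0"
    and pq: "(1 + \<alpha> + \<beta>) * Gpq - \<alpha> * Gqq - \<beta> * Gqx = 0"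
    and qq: "(1 + \<alpha> + \<gamma>) * Gqq - \<alpha> * Gpq - \<gamma> * Gqx = 1"
    and xq: "(k / 2 + \<beta> + \<gamma>) * Gqx - \<beta> * Gpq - \<gamma> * Gqq = 0"
    and px: "(1 + \<alpha> + \<beta>) * Gpx - \<alpha> * Gqx - \<beta> * Gxx = 0"
    and qx: "(1 + \<alpha> + \<gamma>) * Gqx - \<alpha> * Gpx - \<gamma> * Gxx = 0"
    and xx: "(k / 2 + \<beta> + \<gamma>) * Gxx - \<beta> * Gpx - \<gamma> * Gqx = 1"
    and dp: "dp = 1 + \<alpha> + \<beta>" and dq: "dq = 1 + \<alpha> + \<gamma>" and dx: "dx = k - 1 + \<beta> + \<gamma>"
    and Dx: "Dx = dx + (k - 1) * (k - 2) / 2"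
  shows "kemeny V (E N) = dp * Gpp + dq * Gqq + dx * Gxx + (k - 1) * (k - 2) * (Gxx / 4 + 3 / (2 * k)) -
    (dp\<^sup>2 * Gpp + dq\<^sup>2 * Gqq + Dx\<^sup>2 * Gxx + 2 * dp * dq * Gpq + 2 * dp * Dx * Gpx + 2 * dq * Dx * Gqx +
      (k - 1)\<^sup>2 * (k - 2) / 2) / (k * (k - 1) + 4 + 2 * (\<alpha> + \<beta> + \<gamma>))"
proof -
  let ?d = "\<lambda>v. real (degree (E N) v)"
  have "card {c, x} \<le> card C"
    by (intro card_mono) auto
  then have k2: "2 \<le> k"
    by (simp add: k_def)
  note adj = adjacency_E[OF N, folded \<alpha> \<beta> \<gamma>]
  have nonneg: "0 \<le> \<alpha>" "0 \<le> \<beta>" "0 \<le> \<gamma>"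
    by (auto simp: \<alpha> \<beta> \<gamma>)
  note cardY = card_Y[folded k_def]
  have degs: "?d p = dp" "?d q = dq" "?d c = k + 1" "?d x = dx"
    by (simp_all add: degree_eq_sum_adjacency[OF simple_E[OF N]] sum_V adj dp dq dx cardY)
  have degY: "?d y = k - 1" if "y \<in> Y" for y
  proof -
    have "(\<Sum>u\<in>Y. of_bool (y \<noteq> u)) = (\<Sum>u\<in>Y. 1 - (if y = u then 1 else 0 :: real))"
      by (intro sum.cong) auto
    also have "\<dots> = k - 3"
      using that by (simp add: sum_subtractf cardY)
    finally show ?thesis
      using that by (simp add: degree_eq_sum_adjacency[OF simple_E[OF N]] sum_V adj)
  qed
  \<comment> \<open>On \<open>Y\<close> the Green function has the value \<open>t\<close> off the
    diagonal and \<open>t + 1 / k\<close> on it. Subtracting the equations at two vertices of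
    \<open>Y\<close> gives the excess \<open>1 / k\<close>; harmonicity off the diagonal then reads
    \<open>2 * t = Gxx / 2 + 1 / k\<close>.\<close>
  define t where "t = Gxx / 4 + 1 / (2 * k)"
  define g where "g u v =
    (if u = c \<or> v = c then 0
     else if u = p then if v = p then Gpp else if v = q then Gpq else if v = x then Gpx else Gpx / 2
     else if u = q then if v = p then Gpq else if v = q then Gqq else if v = x then Gqx else Gqx / 2
     else if u = x then if v = p then Gpx else if v = q then Gqx else if v = x then Gxx else Gxx / 2
     else if v = p then Gpx / 2 else if v = q then Gqx / 2 else if v = x then Gxx / 2
     else t + (if u = v then 1 / k else 0))" for u v
  have g: "g c v = 0" "g v c = 0"
    "g p p = Gpp" "g p q = Gpq" "g p x = Gpx" "g q p = Gpq" "g q q = Gqq" "g q x = Gqx"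
    "g x p = Gpx" "g x q = Gqx" "g x x = Gxx" for v
    by (simp_all add: g_def)
  have gY: "g p y = Gpx / 2" "g q y = Gqx / 2" "g x y = Gxx / 2"
    "g y p = Gpx / 2" "g y q = Gqx / 2" "g y x = Gxx / 2" if "y \<in> Y" for y
    using that by (simp_all add: g_def)
  have gYY: "g y y' = t + (if y = y' then 1 / k else 0)" if "y \<in> Y" "y' \<in> Y" for y y'
    using that by (simp add: g_def)
  have sum_gYY: "(\<Sum>u\<in>Y. a - g u y) = (k - 2) * (a - t) - 1 / k" if "y \<in> Y" for a y
  proof -
    have "(\<Sum>u\<in>Y. a - g u y) = (\<Sum>u\<in>Y. (a - t) - (if u = y then 1 / k else 0))"
      using that by (intro sum.cong) (simp_all add: gYY)
    also have "\<dots> = (k - 2) * (a - t) - 1 / k"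
      using that by (simp add: sum_subtractf[of "\<lambda>_. a - t"] cardY)
    finally show ?thesis .
  qed
  have sum_gYY_x: "(\<Sum>u\<in>Y. Gxx / 2 - g u y) = (k - 2) * Gxx / 4 - 1 / 2" if "y \<in> Y" for y
    unfolding sum_gYY[OF that] using k2 by (simp add: t_def field_simps)
  \<comment> \<open>The adjacency factor is 0 only at \<open>u = y\<close>, where the difference
    vanishes anyway.\<close>
  have YY: "(\<Sum>u\<in>Y. adjacency (E N) y u * (g y j - g u j)) = (\<Sum>u\<in>Y. g y j - g u j)" if "y \<in> Y" for y j
    using that by (intro sum.cong) (auto simp: adj)
  have t: "k * t = k * Gxx / 4 + 1 / 2"
    using k2 by (simp add: t_def field_simps)
  \<comment> \<open>Inside the double sum the bound vertex \<open>k\<close> shadows the clique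
    size.\<close>
  have "kemeny V (E N) = (\<Sum>j\<in>V. ?d j * g j j) - (\<Sum>j\<in>V. \<Sum>k\<in>V. ?d j * ?d k * g j k) / (\<Sum>j\<in>V. ?d j)"
  proof (rule kemeny_eq_grounded_Green[OF simple_E[OF N], of c])
    show "0 < degree (E N) v" if "v \<in> V" for v
    proof -
      have "0 < ?d v"
        using that nonneg k2 degY by (auto simp: V_cases degs dp dq dx simp del: of_nat_0_less_iff)
      then show ?thesis by simp
    qed
    show "(\<Sum>u\<in>V. adjacency (E N) i u * (g i j - g u j)) = (if i = j then 1 else 0)"
      if ij: "i \<in> V - {c}" "j \<in> V - {c}" for i j
    proof -
      consider "i = p" | "i = q" | "i = x" | "i \<in> Y" using ij by (auto simp: V_cases)
      then show ?thesis
      proof cases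
        case 1
        consider "j = p" | "j = q" | "j = x" | "j \<in> Y" using ij by (auto simp: V_cases)
        then show ?thesis
          using pp pq px unfolding 1
          by cases (auto simp: sum_V adj g gY algebra_simps)
      next
        case 2
        consider "j = p" | "j = q" | "j = x" | "j \<in> Y" using ij by (auto simp: V_cases)
        then show ?thesis
          using qp qq qx unfolding 2
          by cases (auto simp: sum_V adj g gY algebra_simps)
      next
        case 3
        consider "j = p" | "j = q" | "j = x" | "j \<in> Y" using ij by (auto simp: V_cases)
        then show ?thesis
          using xp xq xx unfolding 3
          by cases (simp_all add: sum_V adj g gY sum_gYY_x cardY, simp_all add: field_simps)
      next
        case 4
        consider "j = p" | "j = q" | "j = x" | "j \<in> Y" using ij by (auto simp: V_cases)
        then show ?thesis
          using t k2 4 unfolding sum_V YY[OF 4]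
          by cases (simp_all add: adj g gY sum_gYY cardY, simp_all add: gYY field_simps)
      qed
    qed
  qed (simp_all add: g V_cases)
  also have "(\<Sum>j\<in>V. ?d j) = k * (k - 1) + 4 + 2 * (\<alpha> + \<beta> + \<gamma>)"
    by (simp add: sum_V degs degY cardY dp dq dx algebra_simps)
  \<comment> \<open>Each of the \<open>k - 2\<close> vertices of \<open>Y\<close> has degree
    \<open>k - 1\<close> and diagonal value
    \<open>t + 1 / k = Gxx / 4 + 3 / (2 * k)\<close>.\<close>
  also have "(\<Sum>j\<in>V. ?d j * g j j) =
    dp * Gpp + dq * Gqq + dx * Gxx + (k - 1) * (k - 2) * (Gxx / 4 + 3 / (2 * k))"
    using k2 by (simp add: sum_V degs degY g gYY cardY t_def mult_ac)
  \<comment> \<open>Halved values on \<open>Y\<close> act like half the weight of \<open>Y\<close>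
    placed at \<open>x\<close>, which gives \<open>Dx\<close>. The last summand is what the
    \<open>Y\<close> block contributes beyond the value \<open>Gxx / 4\<close> per pair.\<close>
  also have "(\<Sum>j\<in>V. \<Sum>k\<in>V. ?d j * ?d k * g j k) =
    dp\<^sup>2 * Gpp + dq\<^sup>2 * Gqq + Dx\<^sup>2 * Gxx + 2 * dp * dq * Gpq + 2 * dp * Dx * Gpx + 2 * dq * Dx * Gqx +
      (k - 1)\<^sup>2 * (k - 2) / 2"
  proof -
    have "(\<Sum>j\<in>Y. \<Sum>l\<in>Y. ?d j * ?d l * g j l) = (\<Sum>j\<in>Y. \<Sum>l\<in>Y. (k - 1)\<^sup>2 * t + (if j = l then (k - 1)\<^sup>2 / k else 0))"
      by (intro sum.cong) (simp_all add: degY gYY power2_eq_square distrib_left)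
    also have "\<dots> = (k - 1)\<^sup>2 * (k - 2)\<^sup>2 * t + (k - 1)\<^sup>2 * (k - 2) / k"
      by (simp add: sum.distrib cardY power2_eq_square distrib_left mult_ac)
    also have "\<dots> = (k - 1)\<^sup>2 * (k - 2)\<^sup>2 * Gxx / 4 + (k - 1)\<^sup>2 * (k - 2) / 2"
      using k2 by (simp add: t_def field_simps power2_eq_square)
    finally show ?thesis
      by (simp add: sum_V sum.distrib degs degY g gY cardY Dx power2_eq_square)
        (simp add: field_simps)
  qed
  finally show ?thesis .
qed

section \<open>Closed forms for the four graphs\<close>

lemma kemeny_E_empty:
  defines "k \<equiv> real (card C)"
  assumes "2 \<le> k"
  shows "kemeny V (E {}) = (k ^ 4 - k ^ 3 + 9 * k\<^sup>2 - 11 * k + 8) / (k * (k * (k - 1) + 4))"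
proof -
  have "0 < k * (k - 1) + 4"
    using assms by (intro add_nonneg_pos) auto
  then show ?thesis
    using \<open>2 \<le> k\<close>
    \<comment> \<open>Here p, q and x meet only at the ground, through conductances 1, 1 and
      \<open>k / 2\<close>.\<close>
    by (subst kemeny_E[where N = "{}" and Gpp = 1 and Gqq = 1 and Gpq = 0 and Gpx = 0 and Gqx = 0
          and Gxx = "2 / k", folded k_def, OF _ refl refl refl _ _ _ _ _ _ _ _ _ refl refl refl refl])
      (simp_all add: divide_simps, simp add: algebra_simps power2_eq_square power3_eq_cube power4_eq_xxxx)
qed

lemma kemeny_E_pq:
  defines "k \<equiv> real (card C)"
  assumes "2 \<le> k"
  shows "kemeny V (E {{p, q}}) =
    (k ^ 4 - k ^ 3 / 3 + 37 / 3 * k\<^sup>2 - 17 * k + 12) / (k * (k * (k - 1) + 6))"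
proof -
  have "0 < k * (k - 1) + 6"
    using assms by (intro add_nonneg_pos) auto
  then show ?thesis
    using \<open>2 \<le> k\<close>
    \<comment> \<open>The block of p and q has diagonal entries 2, off-diagonal entries -1 and
      determinant 3.\<close>
    by (subst kemeny_E[where N = "{{p, q}}" and Gpp = "2 / 3" and Gqq = "2 / 3" and Gpq = "1 / 3" and Gpx = 0
          and Gqx = 0 and Gxx = "2 / k", folded k_def,
          OF _ refl refl refl _ _ _ _ _ _ _ _ _ refl refl refl refl])
      (simp_all add: doubleton_eq_iff divide_simps,
       simp add: algebra_simps power2_eq_square power3_eq_cube power4_eq_xxxx)
qed

lemma kemeny_E_px:
  defines "k \<equiv> real (card C)"
  assumes "2 \<le> k"
  shows "kemeny V (E {{p, x}}) =
    (k ^ 5 + 10 * k ^ 3 - 3 * k\<^sup>2 + 2 * k + 18) / (k * (k + 1) * (k * (k - 1) + 6))"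
proof -
  have "0 < k * (k - 1) + 6"
    using assms by (intro add_nonneg_pos) auto
  then show ?thesis
    using \<open>2 \<le> k\<close>
    \<comment> \<open>The block of p and x has diagonal 2, \<open>k / 2 + 1\<close>, off-diagonal
      entries -1 and determinant \<open>k + 1\<close>; q stays separate.\<close>
    by (subst kemeny_E[where N = "{{p, x}}" and Gpp = "(k + 2) / (2 * (k + 1))" and Gqq = 1 and Gpq = 0
          and Gpx = "1 / (k + 1)" and Gqx = 0 and Gxx = "2 / (k + 1)", folded k_def,
          OF _ refl refl refl _ _ _ _ _ _ _ _ _ refl refl refl refl])
      (simp_all add: doubleton_eq_iff divide_simps,
       simp_all add: algebra_simps power2_eq_square power3_eq_cube power4_eq_xxxx eval_nat_numeral)
qed

lemma kemeny_E_triangle: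
  defines "k \<equiv> real (card C)"
  assumes "2 \<le> k"
  shows "kemeny V (E {{p, q}, {p, x}, {q, x}}) =
    (k ^ 5 + 5 / 4 * k ^ 4 + 57 / 4 * k ^ 3 + 11 * k\<^sup>2 - 27 * k + 60) /
      (k * (k + 2) * (k * (k - 1) + 10))"
proof -
  have "0 < k * (k - 1) + 10"
    using assms by (intro add_nonneg_pos) auto
  then show ?thesis
    using \<open>2 \<le> k\<close>
    \<comment> \<open>The symmetry of p and q splits the system: the antisymmetric part gives
      \<open>Gpp - Gpq = 1 / 4\<close>, the symmetric part a two-by-two system of determinant
      \<open>k + 2\<close>.\<close>
    by (subst kemeny_E[where N = "{{p, q}, {p, x}, {q, x}}" and Gpp = "(3 * k + 10) / (8 * (k + 2))"
          and Gqq = "(3 * k + 10) / (8 * (k + 2))" and Gpq = "(k + 6) / (8 * (k + 2))"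
          and Gpx = "1 / (k + 2)" and Gqx = "1 / (k + 2)" and Gxx = "2 / (k + 2)", folded k_def,
          OF _ refl refl refl _ _ _ _ _ _ _ _ _ refl refl refl refl])
      (simp_all add: doubleton_eq_iff divide_simps,
       simp_all add: algebra_simps power2_eq_square power3_eq_cube power4_eq_xxxx eval_nat_numeral)
qed

section \<open>The Braess properties\<close>

lemma connected_E_empty: "connected_graph V (E {})"
proof -
  let ?R = "{(u, v). {u, v} \<in> E {}}"
  have c_adj: "{c, v} \<in> E {}" "{v, c} \<in> E {}" if "v \<in> V" "v \<noteq> c" for v
    using that c by (auto simp: V_def E_def nsets_2_eq insert_commute)
  have "(u, v) \<in> ?R\<^sup>*" if "u \<in> V" "v \<in> V" for u v
  proof -
    have "(u, c) \<in> ?R\<^sup>*"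
      using c_adj[of u] that by (cases "u = c") auto
    also have "(c, v) \<in> ?R\<^sup>*"
      using c_adj[of v] that by (cases "v = c") auto
    finally show ?thesis .
  qed
  then show ?thesis
    using simple_E[of "{}"] by (auto simp: connected_graph_def V_def)
qed

lemma indep_pqx: "indep {p, q, x} (E {})"
  using c x pq by (auto simp: indep_def E_def nsets_2_eq doubleton_eq_iff)

lemma braess_pqx:
  assumes "6 \<le> card C"
  shows "braess_clique V (E {}) 3 {p, q, x}" "braess_edge V (E {}) {p, q}" "\<not> braess_edge V (E {}) {p, x}"
proof -
  have card6: "6 \<le> real (card C)" and card2: "2 \<le> real (card C)"
    using assms by simp_all
  \<comment> \<open>Folding the closed forms turns the rational inequalities into comparisons of
    Kemeny's constants.\<close>
  note ineqs = kemeny_formula_less[OF card6, folded kemeny_E_empty[OF card2] kemeny_E_pq[OF card2]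
      kemeny_E_px[OF card2] kemeny_E_triangle[OF card2]]
  have E_un: "E {} \<union> [{p, q, x}]\<^bsup>2\<^esup> = E {{p, q}, {p, x}, {q, x}}" "E {} \<union> [{p, q}]\<^bsup>2\<^esup> = E {{p, q}}"
    "E {} \<union> [{p, x}]\<^bsup>2\<^esup> = E {{p, x}}"
    by (simp_all add: triple_nsets_2 E_def)
  have "indep {p, q} (E {})"
    using smaller_indep[OF indep_pqx] by auto
  with ineqs connected_E_empty indep_pqx
  show "braess_clique V (E {}) 3 {p, q, x}" "braess_edge V (E {}) {p, q}"
    "\<not> braess_edge V (E {}) {p, x}"
    by (simp_all add: braess_clique_def braess_edge_def E_un V_cases del: nsets_doubleton_2_eq)
qed

end

theorem theorem5p13:
  fixes k :: nat and V :: "'a set" and E :: "'a set set"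
  assumes "k \<ge> 6"
    and "complete_with_two_pendents V E k"
  shows "\<exists>x y z. x \<noteq> y \<and> x \<noteq> z \<and> y \<noteq> z \<and> braess_clique V E 3 {x, y, z} \<and>
    braess_edge V E {x, y} \<and> \<not> braess_edge V E {x, z} \<and> \<not> braess_edge V E {y, z}"
proof -
  from assms(2) obtain C c p q where G: "finite C" "card C = k" "c \<in> C" "p \<notin> C" "q \<notin> C" "p \<noteq> q"
    and V: "V = C \<union> {p, q}" and E: "E = [C]\<^bsup>2\<^esup> \<union> {{c, p}, {c, q}}"
    unfolding complete_with_two_pendents_def by blast
  have "\<not> C \<subseteq> {c}"
    using card_mono[of "{c}" C] assms(1) G(2) by auto
  then obtain x where x: "x \<in> C" "x \<noteq> c" by blast
  interpret pq: clique_with_two_pendents C c p q x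
    using G x by unfold_locales auto
  \<comment> \<open>Exchanging p and q leaves the graph unchanged, so the statement about px also
    yields the one about qx.\<close>
  interpret qp: clique_with_two_pendents C c q p x
    using G x by unfold_locales auto
  have V_eq: "V = pq.V" "V = qp.V" and E_eq: "E = pq.E {}" "E = qp.E {}"
    by (auto simp: V E pq.V_def qp.V_def pq.E_def qp.E_def)
  have "braess_clique V E 3 {p, q, x}" "braess_edge V E {p, q}" "\<not> braess_edge V E {p, x}"
    using pq.braess_pqx assms(1) G(2) by (auto simp flip: V_eq E_eq)
  moreover have "\<not> braess_edge V E {q, x}"
    using qp.braess_pqx(3) assms(1) G(2) by (auto simp flip: V_eq E_eq)
  moreover have "p \<noteq> q" "p \<noteq> x" "q \<noteq> x"
    using G x by auto
  ultimately show ?thesis by blast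
qed

end
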